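(* For each fixed $m,s=0,1,2,\dots$, the generating function for the $q$-deformed Laguerre–Gould–Hopper polynomials ${}_{L}H_{n}^{(m,s)}(x,y,z|q)$ is given by $$\sum_{n=0}^{\infty}\frac{t^{n}}{[n]_{q}!}\;{}_{L}H_{n}^{(m,s)}(x,y,z|q)=e_{q}(yt)\,E_{q^{s}}(zt^{s})\,\varepsilon_{q}^{m}(-xt^{m}),$$ in terms of the exponential functions $e_q$, $E_{q^s}$ and the $(q,m)$-deformed Bessel–Tricomi function $\varepsilon_q^m$.
   Context: Let $q\in\mathbb{C}\setminus\{1\}$. The $q$-analogues of a natural number $n$, the factorial and the semifactorial are $[n]_{q}=\sum_{k=1}^{n}q^{k-1}$, $[n]_{q}!=\prod_{k=1}^{n}[k]_{q}$, $[0]_{q}!=1$, and $[mk]_{q}!!=\prod_{l=1}^{k}[ml]_{q}$, $[0]_q!!=1$; $[n]_{q^m}$ and $[n]_{q^m}!$ denote the corresponding expressions with $q$ replaced by $q^m$. The Euler–Heine–Jackson $q$-difference operator is $D_{x}^{q}[f](x)=\frac{f(x)-f(qx)}{(1-q)x}$, $x\neq 0$, and its inverse $(D_x^q)^{-1}$ is defined in such a way that $(D_{x}^{q})^{-n}(1)=\frac{x^{n}}{[n]_{q}!}$; $D_x^{q^m}$ is the same with $q$ replaced by $q^m$. For $m=0,1,2,\dots$ the exponential functions are $e_{q}(x)=\sum_{n=0}^{\infty}\frac{x^{n}}{[n]_{q}!}$ and $E_{q^{m}}(x)=\sum_{n=0}^{\infty}\frac{q^{m\binom{n}{2}}}{[n]_{q^{m}}!}x^{n}$.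 For $m=0,1,2,\dots$ the $(q,m)$-deformed Bessel–Tricomi function of order $n=0,1,2,\dots$ is $\varepsilon_{n,q}^{m}(x)=\sum_{k=0}^{\infty}\frac{(-1)^{k}q^{m\binom{k}{2}}}{[k]_{q^{m}}!\,[n+k]_{q^{m}}!}x^{k}$, and $\varepsilon_{q}^{m}(x):=\varepsilon_{0,q}^{m}(x)$. Below, $\lfloor a\rfloor$ is the greatest integer not exceeding $a$. The $q$-deformed two-variable (2D) Laguerre polynomials are, for $m,n=0,1,2,\dots$, $${}_{m}L_{n}(x,y|q):=E_{q^{m}}\left((D_{x}^{q^{m}})^{-1}(D_{y}^{q})^{m}\right)(y^{n})=[n]_{q}!\sum_{k=0}^{\lfloor n/m\rfloor}\frac{q^{m\binom{k}{2}}x^{k}y^{n-mk}}{([k]_{q^{m}}!)^{2}\,[n-mk]_{q}!}.$$ The $q$-deformed Gould–Hopper generalized Hermite polynomials are $$\mathcal{G}_{n}^{m}(x,y|q)=[n]_{q}!\sum_{k=0}^{\lfloor n/m\rfloor}\frac{(-1)^{k}q^{m\binom{k}{2}}x^{n-mk}y^{k}}{[n-mk]_{q}!\,[mk]_{q}!!}.$$ For fixed $m,n,s=0,1,2,\dots$, the $q$-deformed Laguerre–Gould–Hopper polynomials are defined by $${}_{L}H_{n}^{(m,s)}(x,y,z|q):=E_{q^{m}}\left((D_{x}^{q^{m}})^{-1}(D_{y}^{q})^{m}\right)\left(\mathcal{G}_{n}^{s}(x,z|q)\right),$$ or equivalently $${}_{L}H_{n}^{(m,s)}(x,y,z|q):=E_{q^{s}}\left(z(D_{y}^{q})^{s}\right)\left({}_{m}L_{n}(x,y|q)\right),$$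 explicitly $${}_{L}H_{n}^{(m,s)}(x,y,z|q)=[n]_{q}!\sum_{k=0}^{\lfloor n/s\rfloor}\frac{q^{s\binom{k}{2}}z^{k}\;{}_{m}L_{n-sk}(x,y|q)}{[k]_{q^{s}}!\,[n-sk]_{q}!}.$$ For $z=0$ they reduce to the $q$-deformed 2D Laguerre polynomials: ${}_{L}H_{n}^{(m,s)}(x,y,0|q)={}_{m}L_{n}(x,y|q)$. *)

theory Defs
  imports "HOL-Analysis.Analysis"
begin

definition qnum :: "complex \<Rightarrow> nat \<Rightarrow> complex" where
  "qnum q n = (\<Sum>k=1..n. q ^ (k - 1))"

definition qfact :: "complex \<Rightarrow> nat \<Rightarrow> complex" where
  "qfact q n = (\<Prod>k=1..n. qnum q k)"

definition qexp :: "complex \<Rightarrow> complex \<Rightarrow> complex" where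
  "qexp q x = (\<Sum>n. x ^ n / qfact q n)"

text \<open>The function \<open>E\<close> with base \<open>p\<close>; it is used with \<open>p = q ^ m\<close>, so that
  \<open>p ^ (n choose 2)\<close> is \<open>q ^ (m * (n choose 2))\<close>.\<close>

definition qExp :: "complex \<Rightarrow> complex \<Rightarrow> complex" where
  "qExp p x = (\<Sum>n. p ^ (n choose 2) / qfact p n * x ^ n)"

definition bessel_tricomi :: "nat \<Rightarrow> complex \<Rightarrow> nat \<Rightarrow> complex \<Rightarrow> complex" where
  "bessel_tricomi n q m x =
     (\<Sum>k. (-1) ^ k * q ^ (m * (k choose 2)) / (qfact (q ^ m) k * qfact (q ^ m) (n + k)) * x ^ k)"

text \<open>The Euler--Heine--Jackson difference operator. The quotient makes sense for nonzero
  arguments only; at \<open>0\<close> we take its continuous extension, so that polynomials are mapped to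
  polynomials (see \<open>qdiff_sum_powers\<close> below).\<close>

definition qdiff :: "complex \<Rightarrow> (complex \<Rightarrow> complex) \<Rightarrow> complex \<Rightarrow> complex" where
  "qdiff q f = (\<lambda>x. if x = 0 then Lim (at 0) (\<lambda>u. (f u - f (q * u)) / ((1 - q) * u))
                   else (f x - f (q * x)) / ((1 - q) * x))"

text \<open>The \<open>n\<close>-th power of the inverse operator, applied to the constant function \<open>1\<close>.\<close>

definition qdiff_inv_one :: "complex \<Rightarrow> nat \<Rightarrow> complex \<Rightarrow> complex" where
  "qdiff_inv_one q n x = x ^ n / qfact q n"

text \<open>The two operational definitions below expand \<open>E\<close> with base \<open>q ^ m\<close> (resp. \<open>q ^ s\<close>) as a
  power series in the operator \<open>D\<^sub>x\<^sup>-\<^sup>1 D\<^sub>y\<^sup>m\<close> (resp. \<open>z D\<^sub>y\<^sup>s\<close>), the operators in \<open>x\<close> and in \<open>y\<close>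
  commuting. For positive \<open>m\<close>, \<open>s\<close> only the terms \<open>m * k \<le> n\<close> (resp. \<open>s * k \<le> n\<close>) survive, which
  gives the familiar finite sums (\<open>qlaguerre_explicit\<close>, \<open>qLGH_explicit\<close>). For \<open>m = 0\<close> or \<open>s = 0\<close>
  all terms survive and the series are genuinely infinite.\<close>

definition qlaguerre :: "complex \<Rightarrow> nat \<Rightarrow> nat \<Rightarrow> complex \<Rightarrow> complex \<Rightarrow> complex" where
  "qlaguerre q m n x y =
     (\<Sum>k. (q ^ m) ^ (k choose 2) / qfact (q ^ m) k *
            (qdiff_inv_one (q ^ m) k x * (qdiff q ^^ (m * k)) (\<lambda>v. v ^ n) y))"

definition qLGH :: "complex \<Rightarrow> nat \<Rightarrow> nat \<Rightarrow> nat \<Rightarrow> complex \<Rightarrow> complex \<Rightarrow> complex \<Rightarrow> complex" where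
  "qLGH q m s n x y z =
     (\<Sum>k. (q ^ s) ^ (k choose 2) / qfact (q ^ s) k *
            (z ^ k * (qdiff q ^^ (s * k)) (\<lambda>v. qlaguerre q m n x v) y))"

lemma qnum_closed: "(1 - q) * qnum q n = 1 - q ^ n"
proof -
  have "qnum q n = (\<Sum>k<n. q ^ k)"
    unfolding qnum_def
    by (rule sum.reindex_bij_witness[of _ Suc "\<lambda>k. k - 1"]) auto
  then show ?thesis
    by (simp add: one_diff_power_eq)
qed

lemma qdiff_sum_powers:
  assumes "q \<noteq> 1" "finite A"
  shows "qdiff q (\<lambda>v. \<Sum>i\<in>A. c i * v ^ d i) = (\<lambda>v. \<Sum>i\<in>A. c i * qnum q (d i) * v ^ (d i - 1))"
proof -
  let ?f = "\<lambda>v. \<Sum>i\<in>A. c i * v ^ d i"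
  let ?g = "\<lambda>v. \<Sum>i\<in>A. c i * qnum q (d i) * v ^ (d i - 1)"
  have eq: "(?f u - ?f (q * u)) / ((1 - q) * u) = ?g u" if "u \<noteq> 0" for u
  proof -
    have "c i * u ^ d i - c i * (q * u) ^ d i = (1 - q) * u * (c i * qnum q (d i) * u ^ (d i - 1))" for i
    proof (cases "d i")
      case 0
      then show ?thesis by (simp add: qnum_def)
    next
      case (Suc e)
      have "c i * u ^ d i - c i * (q * u) ^ d i = c i * u ^ d i * (1 - q ^ d i)"
        by (simp add: power_mult_distrib algebra_simps)
      also have "\<dots> = c i * u ^ d i * ((1 - q) * qnum q (d i))"
        by (simp only: qnum_closed)
      finally show ?thesis using Suc by (simp add: algebra_simps)
    qed
    then have "?f u - ?f (q * u) = (1 - q) * u * ?g u"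
      by (simp add: sum_subtractf[symmetric] sum_distrib_left)
    then show ?thesis using that assms(1) by simp
  qed
  have "((\<lambda>u. (?f u - ?f (q * u)) / ((1 - q) * u)) \<longlongrightarrow> ?g 0) (at 0)"
  proof (rule Lim_transform_eventually)
    show "(?g \<longlongrightarrow> ?g 0) (at 0)"
      by (intro tendsto_intros)
    show "\<forall>\<^sub>F u in at 0. ?g u = (?f u - ?f (q * u)) / ((1 - q) * u)"
      using eq by (auto simp: eventually_at_filter)
  qed
  then have "Lim (at 0) (\<lambda>u. (?f u - ?f (q * u)) / ((1 - q) * u)) = ?g 0"
    by (intro tendsto_Lim) auto
  then show ?thesis
    unfolding qdiff_def using eq by fastforce
qed

lemma qdiff_funpow_sum_powers:
  assumes "q \<noteq> 1" "finite A"
  shows "(qdiff q ^^ j) (\<lambda>v. \<Sum>i\<in>A. c i * v ^ d i) =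
         (\<lambda>v. \<Sum>i\<in>A. c i * (\<Prod>l<j. qnum q (d i - l)) * v ^ (d i - j))"
proof (induction j)
  case (Suc j)
  show ?case
    using Suc qdiff_sum_powers[OF assms, of "\<lambda>i. c i * (\<Prod>l<j. qnum q (d i - l))" "\<lambda>i. d i - j"]
    by (simp add: mult.assoc)
qed simp

lemma prod_qnum:
  assumes "\<And>n. n \<ge> 1 \<Longrightarrow> qnum q n \<noteq> 0"
  shows "(\<Prod>l<j. qnum q (n - l)) = (if j \<le> n then qfact q n / qfact q (n - j) else 0)"
proof (cases "j \<le> n")
  case True
  then show ?thesis
  proof (induction j)
    case 0
    then show ?case using assms by (simp add: qfact_def)
  next
    case (Suc j)
    then have "n - j = Suc (n - Suc j)" by simp
    then have "qfact q (n - j) = qfact q (n - Suc j) * qnum q (n - j)"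
      by (simp add: qfact_def)
    moreover have "qnum q (n - j) \<noteq> 0" using assms Suc.prems by simp
    ultimately show ?case using Suc by simp
  qed
next
  case False
  then have "\<exists>l<j. qnum q (n - l) = 0"
    by (intro exI[of _ n]) (auto simp: qnum_def)
  then show ?thesis using False by auto
qed

lemma qdiff_funpow_sum_powers':
  assumes "q \<noteq> 1" "\<And>n. n \<ge> 1 \<Longrightarrow> qnum q n \<noteq> 0" "finite A"
  shows "(qdiff q ^^ j) (\<lambda>v. \<Sum>i\<in>A. c i * v ^ d i) v =
         (\<Sum>i\<in>A. c i * (if j \<le> d i then qfact q (d i) / qfact q (d i - j) else 0) * v ^ (d i - j))"
  by (simp only: qdiff_funpow_sum_powers[OF assms(1,3)] prod_qnum[OF assms(2)])

lemma qdiff_funpow_power: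
  assumes "q \<noteq> 1" "\<And>n. n \<ge> 1 \<Longrightarrow> qnum q n \<noteq> 0"
  shows "(qdiff q ^^ j) (\<lambda>v. c * v ^ n) v =
         c * (if j \<le> n then qfact q n / qfact q (n - j) else 0) * v ^ (n - j)"
  using qdiff_funpow_sum_powers'[OF assms, of "{()}" j "\<lambda>_. c" "\<lambda>_. n" v] by simp

lemma le_div_iff_mult_le: "m > 0 \<Longrightarrow> k \<le> n div m \<longleftrightarrow> m * k \<le> (n::nat)"
  by (simp add: less_eq_div_iff_mult_less_eq mult.commute)

lemma qlaguerre_explicit:
  assumes "q \<noteq> 1" "\<And>n. n \<ge> 1 \<Longrightarrow> qnum q n \<noteq> 0" "m > 0"
  shows "qlaguerre q m n x y = qfact q n *
    (\<Sum>k=0..n div m. q ^ (m * (k choose 2)) * x ^ k * y ^ (n - m * k) /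
                      ((qfact (q ^ m) k)\<^sup>2 * qfact q (n - m * k)))"
  unfolding qlaguerre_def sum_distrib_left
  by (subst suminf_finite[where N = "{0..n div m}"])
     (auto intro!: sum.cong simp: qdiff_funpow_power[OF assms(1,2), where c = 1, simplified]
        le_div_iff_mult_le[OF assms(3)] qdiff_inv_one_def power_mult power2_eq_square mult_ac)

lemma qlaguerre_0: "qlaguerre q 0 n x y = (\<Sum>k. x ^ k / (fact k)\<^sup>2 * y ^ n)"
proof -
  have "qfact 1 k = fact k" for k
    by (induction k) (simp_all add: qfact_def qnum_def)
  then show ?thesis
    by (simp add: qlaguerre_def qdiff_inv_one_def power2_eq_square)
qed

lemma qdiff_funpow_qlaguerre:
  assumes "q \<noteq> 1" "\<And>n. n \<ge> 1 \<Longrightarrow> qnum q n \<noteq> 0" "m > 0"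
  shows "(qdiff q ^^ j) (\<lambda>v. qlaguerre q m n x v) y =
         (if j \<le> n then qfact q n / qfact q (n - j) * qlaguerre q m (n - j) x y else 0)"
proof -
  have nz: "qfact q n \<noteq> 0" for n
    using assms(2) by (simp add: qfact_def)
  define c where "c k = qfact q n * q ^ (m * (k choose 2)) * x ^ k /
                      ((qfact (q ^ m) k)\<^sup>2 * qfact q (n - m * k))" for k
  have "(\<lambda>v. qlaguerre q m n x v) = (\<lambda>v. \<Sum>k=0..n div m. c k * v ^ (n - m * k))"
    by (simp add: qlaguerre_explicit[OF assms] c_def sum_distrib_left mult.assoc)
  then have *: "(qdiff q ^^ j) (\<lambda>v. qlaguerre q m n x v) y =
     (\<Sum>k=0..n div m. c k * (if j \<le> n - m * k then qfact q (n - m * k) / qfact q (n - m * k - j) else 0)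
        * y ^ (n - m * k - j))"
    by (simp add: qdiff_funpow_sum_powers'[OF assms(1,2)])
  show ?thesis
  proof (cases "j \<le> n")
    case True
    have "(qdiff q ^^ j) (\<lambda>v. qlaguerre q m n x v) y = (\<Sum>k=0..(n - j) div m.
        c k * (qfact q (n - m * k) / qfact q (n - m * k - j)) * y ^ (n - m * k - j))"
      unfolding *
    proof (intro sum.mono_neutral_cong_right)
      show "{0..(n - j) div m} \<subseteq> {0..n div m}"
        by (simp add: div_le_mono)
    qed (use True in \<open>auto simp: le_div_iff_mult_le[OF assms(3)]\<close>)
    also have "\<dots> = (\<Sum>k=0..(n - j) div m. qfact q n / qfact q (n - j) * (qfact q (n - j) *
          (q ^ (m * (k choose 2)) * x ^ k * y ^ (n - j - m * k) /
             ((qfact (q ^ m) k)\<^sup>2 * qfact q (n - j - m * k)))))"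
    proof (intro sum.cong refl)
      fix k
      have "n - j - m * k = n - m * k - j" by simp
      then show "c k * (qfact q (n - m * k) / qfact q (n - m * k - j)) * y ^ (n - m * k - j) =
        qfact q n / qfact q (n - j) * (qfact q (n - j) *
          (q ^ (m * (k choose 2)) * x ^ k * y ^ (n - j - m * k) /
             ((qfact (q ^ m) k)\<^sup>2 * qfact q (n - j - m * k))))"
        using nz by (simp add: c_def)
    qed
    also have "\<dots> = qfact q n / qfact q (n - j) * qlaguerre q m (n - j) x y"
      by (simp only: qlaguerre_explicit[OF assms] sum_distrib_left)
    finally show ?thesis using True by simp
  next
    case False
    then show ?thesis unfolding * by (auto intro!: sum.neutral)
  qed
qed

lemma qLGH_explicit:
  assumes "q \<noteq> 1" "\<And>n. n \<ge> 1 \<Longrightarrow> qnum q n \<noteq> 0" "m > 0" "s > 0"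
  shows "qLGH q m s n x y z = qfact q n *
    (\<Sum>k=0..n div s. q ^ (s * (k choose 2)) * z ^ k * qlaguerre q m (n - s * k) x y /
                      (qfact (q ^ s) k * qfact q (n - s * k)))"
  unfolding qLGH_def sum_distrib_left
  by (subst suminf_finite[where N = "{0..n div s}"])
     (auto intro!: sum.cong simp: qdiff_funpow_qlaguerre[OF assms(1-3)]
        le_div_iff_mult_le[OF assms(4)] power_mult)

end

(* Dividing by [n]_q! turns both the Laguerre polynomials and the Laguerre-Gould-Hopper polynomials
   into convolutions of coefficient sequences in which one index is dilated by m or s. Multiplication
   by t^n distributes over such a convolution, and the sum of a dilated convolution of absolutely
   summable sequences is the product of the sums, so the factors e_q, E and the Bessel-Tricomi
   function split off one after the other. *)

theory Submission
  imports Defs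
begin

section \<open>Dilated convolutions\<close>

text \<open>For \<open>s = 0\<close> the series is infinite and equals \<open>(\<Sum>k. a k) * b n\<close>.\<close>

definition dilated_conv :: "nat \<Rightarrow> (nat \<Rightarrow> complex) \<Rightarrow> (nat \<Rightarrow> complex) \<Rightarrow> nat \<Rightarrow> complex" where
  "dilated_conv s a b n = (\<Sum>k. if s * k \<le> n then a k * b (n - s * k) else 0)"

text \<open>For \<open>s > 0\<close> the guard confines the support to \<open>k \<le> n\<close>. For
  \<open>s = 0\<close> it always holds and the terms are a fixed multiple of \<open>a\<close>, so
  summability of \<open>a\<close> carries over.\<close>

lemma summable_dilated_conv_terms:
  fixes a b :: "nat \<Rightarrow> complex"
  assumes "s = 0 \<Longrightarrow> summable a"
  shows "summable (\<lambda>k. if s * k \<le> n then a k * b (n - s * k) else 0)"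
proof (cases "s = 0")
  case True
  then show ?thesis using assms by (simp add: summable_mult2)
next
  case False
  show ?thesis
  proof (rule summable_finite)
    show "finite {..n}" by simp
    show "(if s * k \<le> n then a k * b (n - s * k) else 0) = 0" if "k \<notin> {..n}" for k
    proof -
      have "k \<le> s * k" using False by simp
      then have "\<not> s * k \<le> n" using that unfolding atMost_iff by linarith
      then show ?thesis by simp
    qed
  qed
qed

lemma dilated_conv_0: "summable a \<Longrightarrow> dilated_conv 0 a b n = (\<Sum>k. a k) * b n"
  by (simp add: dilated_conv_def suminf_mult2)

text \<open>Inside the guard \<open>t ^ n\<close> splits as
  \<open>t ^ (s * k) * t ^ (n - s * k)\<close>, so each sequence absorbs its own power of
  \<open>t\<close>.\<close>

lemma dilated_conv_scale:
  assumes "s = 0 \<Longrightarrow> summable a"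
  shows "t ^ n * dilated_conv s a b n = dilated_conv s (\<lambda>k. a k * t ^ (s * k)) (\<lambda>j. b j * t ^ j) n"
proof -
  have "t ^ n * dilated_conv s a b n =
      (\<Sum>k. t ^ n * (if s * k \<le> n then a k * b (n - s * k) else 0))"
    unfolding dilated_conv_def
    by (rule suminf_mult[symmetric]) (rule summable_dilated_conv_terms[OF assms])
  also have "\<dots> = dilated_conv s (\<lambda>k. a k * t ^ (s * k)) (\<lambda>j. b j * t ^ j) n"
    unfolding dilated_conv_def
  proof (intro suminf_cong)
    fix k
    have "t ^ n = t ^ (s * k) * t ^ (n - s * k)" if "s * k \<le> n"
      using that by (simp flip: power_add)
    then show "t ^ n * (if s * k \<le> n then a k * b (n - s * k) else 0) =
        (if s * k \<le> n then a k * t ^ (s * k) * (b (n - s * k) * t ^ (n - s * k)) else 0)"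
      by simp
  qed
  finally show ?thesis .
qed

text \<open>For \<open>s > 0\<close>, if \<open>a\<close> lists the coefficients of a power series
  A(X), these are the coefficients of A(X^s).\<close>

definition dilate :: "nat \<Rightarrow> (nat \<Rightarrow> 'a) \<Rightarrow> nat \<Rightarrow> 'a::zero" where
  "dilate s a i = (if s dvd i then a (i div s) else 0)"

lemma dilate_sums_iff:
  fixes a :: "nat \<Rightarrow> 'a::real_normed_vector"
  assumes "s > 0"
  shows "dilate s a sums c \<longleftrightarrow> a sums c"
proof -
  have "strict_mono (\<lambda>k. s * k)"
    using assms by (simp add: strict_mono_def)
  moreover have "dilate s a i = 0" if "i \<notin> range (\<lambda>k. s * k)" for i
    using that by (auto simp: dilate_def elim!: dvdE)
  ultimately have "(\<lambda>k. dilate s a (s * k)) sums c \<longleftrightarrow> dilate s a sums c"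
    by (rule sums_mono_reindex)
  then show ?thesis
    using assms by (simp add: dilate_def)
qed

text \<open>Padding \<open>a\<close> with zeros through the bijection \<open>k\<close> to
  \<open>s * k\<close> gives an ordinary Cauchy product, to which the classical product theorem
  applies.\<close>

lemma dilated_conv_eq_cauchy_product:
  assumes "s > 0"
  shows "dilated_conv s a b n = (\<Sum>i\<le>n. dilate s a i * b (n - i))"
proof -
  have "k \<le> n" if "s * k \<le> n" for k
    by (rule le_trans[OF _ that]) (use assms in simp)
  then have "{k. s * k \<le> n} \<subseteq> {..n}"
    by blast
  then have fin: "finite {k. s * k \<le> n}"
    by (rule finite_subset) simp
  have "dilated_conv s a b n = (\<Sum>k | s * k \<le> n. a k * b (n - s * k))"
    unfolding dilated_conv_def by (subst suminf_finite[OF fin]) (auto intro!: sum.cong)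
  also have "\<dots> = (\<Sum>i | i \<le> n \<and> s dvd i. dilate s a i * b (n - i))"
    using assms
    by (intro sum.reindex_bij_witness[of _ "\<lambda>i. i div s" "\<lambda>k. s * k"]) (auto simp: dilate_def)
  also have "\<dots> = (\<Sum>i\<le>n. dilate s a i * b (n - i))"
    by (intro sum.mono_neutral_left) (auto simp: dilate_def)
  finally show ?thesis .
qed

text \<open>For \<open>s = 0\<close> the convolution is a constant multiple of \<open>b\<close>; for
  \<open>s > 0\<close> it is a Cauchy product. Absolute summability is part of the conclusion so
  that the result can be convolved again.\<close>

lemma dilated_conv_sums:
  assumes a: "summable (\<lambda>k. norm (a k))" and b: "summable (\<lambda>k. norm (b k))"
  shows "summable (\<lambda>n. norm (dilated_conv s a b n))"
    and "dilated_conv s a b sums ((\<Sum>k. a k) * (\<Sum>k. b k))"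
proof -
  have "summable (\<lambda>n. norm (dilated_conv s a b n)) \<and>
      dilated_conv s a b sums ((\<Sum>k. a k) * (\<Sum>k. b k))"
  proof (cases "s = 0")
    case True
    have "dilated_conv s a b = (\<lambda>n. (\<Sum>k. a k) * b n)"
      using dilated_conv_0[OF summable_norm_cancel[OF a]] True by blast
    then show ?thesis
      using b by (simp add: norm_mult summable_mult sums_mult summable_sums summable_norm_cancel)
  next
    case False
    then have s: "s > 0" by simp
    have "(\<lambda>i. norm (dilate s a i)) = dilate s (\<lambda>k. norm (a k))"
      by (auto simp: dilate_def)
    then have da: "summable (\<lambda>i. norm (dilate s a i))"
      using a dilate_sums_iff[OF s, of "\<lambda>k. norm (a k)"] by (simp add: summable_def)
    have "dilate s a sums (\<Sum>k. a k)"
      using dilate_sums_iff[OF s] a by (blast intro: summable_sums summable_norm_cancel)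
    then have suma: "(\<Sum>i. dilate s a i) = (\<Sum>k. a k)"
      by (rule sums_unique[symmetric])
    have conv: "dilated_conv s a b = (\<lambda>n. \<Sum>i\<le>n. dilate s a i * b (n - i))"
      using dilated_conv_eq_cauchy_product[OF s] by blast
    have "dilated_conv s a b sums ((\<Sum>k. a k) * (\<Sum>k. b k))"
      unfolding conv suma[symmetric] by (rule Cauchy_product_sums[OF da b])
    \<comment> \<open>By the triangle inequality, the Cauchy product of the norm sequences is a
      majorant.\<close>
    moreover have "summable (\<lambda>n. norm (dilated_conv s a b n))"
    proof (rule summable_comparison_test')
      show "summable (\<lambda>n. \<Sum>i\<le>n. norm (dilate s a i) * norm (b (n - i)))"
        using da b by (intro summable_Cauchy_product) auto
      show "norm (norm (dilated_conv s a b n)) \<le> (\<Sum>i\<le>n. norm (dilate s a i) * norm (b (n - i)))"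
        for n
        unfolding conv by (simp add: sum_norm_le norm_mult)
    qed
    ultimately show ?thesis by blast
  qed
  then show "summable (\<lambda>n. norm (dilated_conv s a b n))"
    and "dilated_conv s a b sums ((\<Sum>k. a k) * (\<Sum>k. b k))" by blast+
qed

section \<open>Laguerre and Laguerre--Gould--Hopper polynomials as dilated convolutions\<close>

lemma qfact_nonzero:
  assumes "\<And>n. n \<ge> 1 \<Longrightarrow> qnum q n \<noteq> 0"
  shows "qfact q n \<noteq> 0"
  using assms by (simp add: qfact_def)

lemma qfact_1: "qfact 1 k = fact k"
  by (induction k) (simp_all add: qfact_def qnum_def)

text \<open>For \<open>m = 0\<close> the base \<open>q ^ 0 = 1\<close> turns q-factorials into
  factorials and leaves this series, which the exponential series at \<open>norm x\<close>
  dominates.\<close>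

lemma summable_power_div_fact_squared: "summable (\<lambda>k. x ^ k / (fact k)\<^sup>2 :: complex)"
proof (rule summable_comparison_test')
  show "summable (\<lambda>k. norm x ^ k / fact k)"
    using summable_exp[of "norm x"] by (simp add: field_simps)
  fix k :: nat
  have "fact k * 1 \<le> fact k * (fact k :: real)"
    by (intro mult_left_mono fact_ge_1) simp
  then show "norm (x ^ k / (fact k)\<^sup>2) \<le> norm x ^ k / fact k"
    by (simp add: norm_divide norm_power power2_eq_square norm_mult frac_le)
qed

lemma qlaguerre_0_factor: "qlaguerre q 0 n x y = (\<Sum>k. x ^ k / (fact k)\<^sup>2) * y ^ n"
  unfolding qlaguerre_0 by (rule suminf_mult2[symmetric]) (rule summable_power_div_fact_squared)

text \<open>Covers \<open>m = 0\<close> as well: there \<open>qlaguerre\<close> is a constant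
  multiple of \<open>y ^ n\<close>, and the rule for monomials applies.\<close>

lemma qdiff_funpow_qlaguerre_all:
  assumes "q \<noteq> 1" "\<And>n. n \<ge> 1 \<Longrightarrow> qnum q n \<noteq> 0"
  shows "(qdiff q ^^ j) (\<lambda>v. qlaguerre q m n x v) y =
         (if j \<le> n then qfact q n / qfact q (n - j) * qlaguerre q m (n - j) x y else 0)"
proof (cases "m = 0")
  case True
  then show ?thesis
    by (simp add: qlaguerre_0_factor qdiff_funpow_power[OF assms])
next
  case False
  then show ?thesis
    using qdiff_funpow_qlaguerre[OF assms] by blast
qed

text \<open>One factorial in the square comes from the series of E, the other from
  \<open>qdiff_inv_one\<close>. These are the terms of the Bessel-Tricomi series of order 0 at
  \<open>- x\<close>.\<close>

definition qlaguerre_coeff :: "complex \<Rightarrow> nat \<Rightarrow> complex \<Rightarrow> nat \<Rightarrow> complex" where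
  "qlaguerre_coeff q m x k = (q ^ m) ^ (k choose 2) * x ^ k / (qfact (q ^ m) k)\<^sup>2"

definition qExp_coeff :: "complex \<Rightarrow> complex \<Rightarrow> nat \<Rightarrow> complex" where
  "qExp_coeff p z k = p ^ (k choose 2) * z ^ k / qfact p k"

lemma summable_qlaguerre_coeff_0: "summable (qlaguerre_coeff q 0 x)"
  using summable_power_div_fact_squared[of x] by (simp add: qlaguerre_coeff_def[abs_def] qfact_1)

lemma summable_qExp_coeff_1: "summable (qExp_coeff 1 z)"
  using summable_exp[of z] by (simp add: qExp_coeff_def[abs_def] qfact_1 field_simps)

text \<open>Applying \<open>qdiff q\<close> to \<open>v ^ n\<close> exactly \<open>m * k\<close>
  times yields the ratio of \<open>qfact q n\<close> to \<open>qfact q (n - m * k)\<close>, or zero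
  once \<open>m * k > n\<close>; the latter is the guard of \<open>dilated_conv\<close>.\<close>

lemma qlaguerre_dilated_conv:
  assumes "q \<noteq> 1" "\<And>n. n \<ge> 1 \<Longrightarrow> qnum q n \<noteq> 0"
  shows "qlaguerre q m n x y / qfact q n =
    dilated_conv m (qlaguerre_coeff q m x) (\<lambda>j. y ^ j / qfact q j) n"
proof -
  let ?b = "\<lambda>j. y ^ j / qfact q j"
  have summ: "summable (\<lambda>k. if m * k \<le> n then qlaguerre_coeff q m x k * ?b (n - m * k) else 0)"
    by (rule summable_dilated_conv_terms) (simp add: summable_qlaguerre_coeff_0)
  have "qlaguerre q m n x y =
      (\<Sum>k. qfact q n * (if m * k \<le> n then qlaguerre_coeff q m x k * ?b (n - m * k) else 0))"
    unfolding qlaguerre_def qdiff_inv_one_def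
    by (intro suminf_cong)
       (simp add: qdiff_funpow_power[OF assms, where c = 1, simplified] qlaguerre_coeff_def
          power2_eq_square mult_ac)
  also have "\<dots> = qfact q n * dilated_conv m (qlaguerre_coeff q m x) ?b n"
    unfolding dilated_conv_def by (rule suminf_mult[OF summ])
  finally show ?thesis
    using qfact_nonzero[OF assms(2)] by simp
qed

lemma qLGH_dilated_conv:
  assumes "q \<noteq> 1" "\<And>n. n \<ge> 1 \<Longrightarrow> qnum q n \<noteq> 0"
  shows "qLGH q m s n x y z / qfact q n =
    dilated_conv s (qExp_coeff (q ^ s) z) (\<lambda>j. qlaguerre q m j x y / qfact q j) n"
proof -
  let ?b = "\<lambda>j. qlaguerre q m j x y / qfact q j"
  have summ: "summable (\<lambda>k. if s * k \<le> n then qExp_coeff (q ^ s) z k * ?b (n - s * k) else 0)"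
    by (rule summable_dilated_conv_terms) (simp add: summable_qExp_coeff_1)
  have "qLGH q m s n x y z =
      (\<Sum>k. qfact q n * (if s * k \<le> n then qExp_coeff (q ^ s) z k * ?b (n - s * k) else 0))"
    unfolding qLGH_def
    by (intro suminf_cong) (simp add: qdiff_funpow_qlaguerre_all[OF assms] qExp_coeff_def mult_ac)
  also have "\<dots> = qfact q n * dilated_conv s (qExp_coeff (q ^ s) z) ?b n"
    unfolding dilated_conv_def by (rule suminf_mult[OF summ])
  finally show ?thesis
    using qfact_nonzero[OF assms(2)] by simp
qed

section \<open>The generating function\<close>

text \<open>Since \<open>(1 - q) * qnum q n = 1 - q ^ n\<close>, the first two hypotheses say that
  \<open>q\<close> is not a root of unity. The other three are absolute convergence of the three
  factor series.\<close>

theorem proposition3p1: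
  fixes q x y z t :: complex and m s :: nat
  assumes "q \<noteq> 1"
    and "\<And>n. n \<ge> 1 \<Longrightarrow> qnum q n \<noteq> 0"
    and "summable (\<lambda>n. norm ((y * t) ^ n / qfact q n))"
    and "summable (\<lambda>n. norm ((q ^ s) ^ (n choose 2) / qfact (q ^ s) n * (z * t ^ s) ^ n))"
    and "summable (\<lambda>k. norm ((-1) ^ k * q ^ (m * (k choose 2)) /
            (qfact (q ^ m) k * qfact (q ^ m) k) * (- x * t ^ m) ^ k))"
  shows "(\<lambda>n. t ^ n / qfact q n * qLGH q m s n x y z) sums
           (qexp q (y * t) * qExp (q ^ s) (z * t ^ s) * bessel_tricomi 0 q m (- x * t ^ m))"
proof -
  define e where "e = (\<lambda>j. y ^ j / qfact q j * t ^ j)"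
  define f where "f = (\<lambda>k. qExp_coeff (q ^ s) z k * t ^ (s * k))"
  define g where "g = (\<lambda>k. qlaguerre_coeff q m x k * t ^ (m * k))"
  define h where "h = (\<lambda>j. qlaguerre q m j x y / qfact q j * t ^ j)"
  have e: "e = (\<lambda>n. (y * t) ^ n / qfact q n)"
    by (simp add: e_def power_mult_distrib)
  have f: "f = (\<lambda>n. (q ^ s) ^ (n choose 2) / qfact (q ^ s) n * (z * t ^ s) ^ n)"
    by (simp add: f_def qExp_coeff_def power_mult_distrib power_mult mult.assoc)
  have g: "g = (\<lambda>k. (-1) ^ k * q ^ (m * (k choose 2)) /
            (qfact (q ^ m) k * qfact (q ^ m) k) * (- x * t ^ m) ^ k)"
  proof
    fix k
    have "(- x * t ^ m) ^ k = (-1) ^ k * (x ^ k * t ^ (m * k))"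
      by (simp add: power_mult_distrib power_mult power_minus[of "x * t ^ m"])
    \<comment> \<open>The sign in the Bessel-Tricomi coefficient cancels the one from its negated
      argument.\<close>
    moreover have "(-1) ^ k * (-1) ^ k = (1 :: complex)"
      by (simp flip: power_mult_distrib)
    ultimately show "g k = (-1) ^ k * q ^ (m * (k choose 2)) /
            (qfact (q ^ m) k * qfact (q ^ m) k) * (- x * t ^ m) ^ k"
      by (simp add: g_def qlaguerre_coeff_def power_mult power2_eq_square)
  qed
  have h: "h = dilated_conv m g e"
  proof
    fix n
    have "h n = t ^ n * dilated_conv m (qlaguerre_coeff q m x) (\<lambda>j. y ^ j / qfact q j) n"
      by (simp add: h_def qlaguerre_dilated_conv[OF assms(1,2)])
    also have "\<dots> = dilated_conv m g e n"
      unfolding g_def e_def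
      by (rule dilated_conv_scale) (simp add: summable_qlaguerre_coeff_0)
    finally show "h n = dilated_conv m g e n" .
  qed
  have LGH: "t ^ n / qfact q n * qLGH q m s n x y z = dilated_conv s f h n" for n
  proof -
    have "t ^ n / qfact q n * qLGH q m s n x y z = t ^ n * (qLGH q m s n x y z / qfact q n)"
      by simp
    also have "\<dots> = t ^ n *
        dilated_conv s (qExp_coeff (q ^ s) z) (\<lambda>j. qlaguerre q m j x y / qfact q j) n"
      by (simp add: qLGH_dilated_conv[OF assms(1,2)])
    also have "\<dots> = dilated_conv s f h n"
      unfolding f_def h_def
      by (rule dilated_conv_scale) (simp add: summable_qExp_coeff_1)
    finally show ?thesis .
  qed
  have ne: "summable (\<lambda>k. norm (e k))" and nf: "summable (\<lambda>k. norm (f k))"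
    and ng: "summable (\<lambda>k. norm (g k))"
    using assms(3-5) by (simp_all only: e f g)
  \<comment> \<open>This is the generating function of the Laguerre polynomials; its absolute
    convergence permits the second convolution, with \<open>f\<close>.\<close>
  have "summable (\<lambda>k. norm (h k))" and sum_h: "h sums ((\<Sum>k. g k) * (\<Sum>k. e k))"
    unfolding h by (rule dilated_conv_sums[OF ng ne])+
  then have "dilated_conv s f h sums ((\<Sum>k. f k) * (\<Sum>k. h k))"
    by (intro dilated_conv_sums(2) nf)
  also have "(\<Sum>k. h k) = (\<Sum>k. g k) * (\<Sum>k. e k)"
    using sum_h by (rule sums_unique[symmetric])
  finally have "dilated_conv s f h sums ((\<Sum>k. e k) * (\<Sum>k. f k) * (\<Sum>k. g k))"
    by (simp only: mult_ac)
  moreover have "(\<Sum>k. e k) = qexp q (y * t)"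
    by (simp only: e qexp_def)
  moreover have "(\<Sum>k. f k) = qExp (q ^ s) (z * t ^ s)"
    by (simp only: f qExp_def)
  moreover have "(\<Sum>k. g k) = bessel_tricomi 0 q m (- x * t ^ m)"
    by (simp only: g bessel_tricomi_def add_0)
  ultimately show ?thesis
    by (simp only: LGH)
qed

end
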